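(* Let $r\geq 2$ be an integer and let $T$ be a tree with $\ell\geq 1$ vertices. For any $K_{r+1}$-free graph $G$, we have $$\rho(G)^\ell\leq\left(1-\frac1r\right)\cdot\#\{\text{homomorphisms from }T\text{ to }G\}.$$
   Context: Graphs are finite and simple; $K_{r+1}$ is the complete graph on $r+1$ vertices, and $G$ is $K_{r+1}$-free if it has no subgraph isomorphic to $K_{r+1}$. The spectral radius $\rho(G)$ is the largest eigenvalue of the adjacency matrix of $G$. A homomorphism from $T$ to $G$ is a map $V(T)\to V(G)$ sending every edge of $T$ to an edge of $G$. *)

theory Defs
  imports
    "HOL-Library.FuncSet"
    "Graph_Theory.Graph_Theory"
    "Jordan_Normal_Form.Spectral_Radius"
begin

text \<open>
  Finite simple graphs are the symmetric, loop-free digraphs without parallel arcs of the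
  Graph_Theory library (locale \<open>graph\<close>), so that an undirected edge \<open>uv\<close> is the pair of
  arcs \<open>(u, v)\<close>, \<open>(v, u)\<close>. The null graph is allowed.
\<close>

definition clique_free :: "nat \<Rightarrow> ('a, 'b) pre_digraph \<Rightarrow> bool" where
  "clique_free n G \<longleftrightarrow> \<not> (\<exists>H. Digraph_Component.subgraph H G \<and> complete_digraph n H)"

text \<open>
  The library predicate \<open>tree\<close> is of no use for symmetric digraphs, since there the closed walk
  \<open>u, v, u\<close> along a single edge counts as a cycle. In a simple graph the cycles in the undirected
  sense are exactly the library's cycles with at least three arcs. Library connectedness includes
  that there is at least one vertex.
\<close>

definition graph_tree :: "('a, 'b) pre_digraph \<Rightarrow> bool" where
  "graph_tree T \<longleftrightarrow>
     graph T \<and> Digraph_Component.connected T \<and>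
     \<not> (\<exists>p. pre_digraph.cycle T p \<and> 3 \<le> length p)"

definition vertex_list :: "('a, 'b) pre_digraph \<Rightarrow> 'a list" where
  "vertex_list G = (SOME vs. distinct vs \<and> set vs = verts G)"

definition adjacency_matrix :: "('a, 'b) pre_digraph \<Rightarrow> real mat" where
  "adjacency_matrix G =
     (let vs = vertex_list G; n = length vs in
      mat n n (\<lambda>(i, j). if (vs ! i, vs ! j) \<in> arcs_ends G then 1 else 0))"

text \<open>
  The largest (real) eigenvalue. The null graph has no eigenvalue at all; its spectral radius is
  0 by convention. Note that the library's \<open>spectral_radius\<close> is instead the largest modulus of a
  complex eigenvalue.
\<close>

definition graph_spectral_radius :: "('a, 'b) pre_digraph \<Rightarrow> real" where
  "graph_spectral_radius G =
     (if verts G = {} then 0 else Max (spectrum (adjacency_matrix G)))"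

text \<open>
  Homomorphisms are taken to be extensional (undefined outside the vertex set of \<open>T\<close>), so that
  each map on the vertices is counted once.
\<close>

definition graph_homs :: "('a, 'b) pre_digraph \<Rightarrow> ('c, 'd) pre_digraph \<Rightarrow> ('a \<Rightarrow> 'c) set" where
  "graph_homs T G =
     {f \<in> verts T \<rightarrow>\<^sub>E verts G. \<forall>(u, v) \<in> arcs_ends T. (f u, f v) \<in> arcs_ends G}"

lemma vertex_list:
  assumes "finite (verts G)"
  shows "distinct (vertex_list G)" "set (vertex_list G) = verts G"
    "length (vertex_list G) = card (verts G)"
proof -
  obtain vs where "distinct vs \<and> set vs = verts G"
    using finite_distinct_list[OF assms] by blast
  then have "distinct (vertex_list G) \<and> set (vertex_list G) = verts G"
    unfolding vertex_list_def by (rule someI)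
  then show "distinct (vertex_list G)" "set (vertex_list G) = verts G"
    "length (vertex_list G) = card (verts G)"
    using distinct_card by fastforce+
qed

text \<open>The spectrum does not depend on the chosen enumeration of the vertices.\<close>

lemma eigenvalue_adjacency_matrix_iff:
  assumes fin: "finite (verts G)"
  shows "eigenvalue (adjacency_matrix G) k \<longleftrightarrow>
    (\<exists>x. (\<exists>v\<in>verts G. x v \<noteq> 0) \<and>
         (\<forall>u\<in>verts G. (\<Sum>v | v \<in> verts G \<and> (u, v) \<in> arcs_ends G. x v) = k * x u))"
    (is "_ \<longleftrightarrow> ?R")
proof -
  define vs where "vs = vertex_list G"
  define n where "n = length vs"
  have dist: "distinct vs" and vset: "set vs = verts G"
    unfolding vs_def by (rule vertex_list[OF fin])+
  have bij: "bij_betw (\<lambda>i. vs ! i) {..<n} (verts G)"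
    by (rule bij_betw_nth[OF dist]) (simp_all add: n_def vset)
  let ?A = "adjacency_matrix G"
  have A: "?A = mat n n (\<lambda>(i, j). if (vs ! i, vs ! j) \<in> arcs_ends G then 1 else 0)"
    by (simp add: adjacency_matrix_def vs_def n_def Let_def)
  have row: "(?A *\<^sub>v w) $ i =
      (\<Sum>v | v \<in> verts G \<and> (vs ! i, v) \<in> arcs_ends G. x v)"
    if i: "i < n" and w: "w \<in> carrier_vec n" and x: "\<And>j. j < n \<Longrightarrow> w $ j = x (vs ! j)"
    for w i and x :: "'a \<Rightarrow> real"
  proof -
    have "(?A *\<^sub>v w) $ i =
        (\<Sum>j<n. (if (vs ! i, vs ! j) \<in> arcs_ends G then x (vs ! j) else 0))"
      using i w x by (auto simp: A scalar_prod_def lessThan_atLeast0 intro!: sum.cong)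
    also have "\<dots> = (\<Sum>v\<in>verts G. (if (vs ! i, v) \<in> arcs_ends G then x v else 0))"
      by (rule sum.reindex_bij_betw[OF bij])
    also have "\<dots> = (\<Sum>v | v \<in> verts G \<and> (vs ! i, v) \<in> arcs_ends G. x v)"
      by (rule sum.inter_filter[symmetric, OF fin])
    finally show ?thesis .
  qed
  have dim: "dim_row ?A = n" by (simp add: A)
  show ?thesis
  proof
    assume "eigenvalue ?A k"
    then obtain w where w: "w \<in> carrier_vec n" "w \<noteq> 0\<^sub>v n" "?A *\<^sub>v w = k \<cdot>\<^sub>v w"
      by (auto simp: eigenvalue_def eigenvector_def dim)
    define x where "x v = w $ the_inv_into {..<n} (\<lambda>i. vs ! i) v" for v
    have x: "w $ j = x (vs ! j)" if "j < n" for j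
      using that the_inv_into_f_f[OF bij_betw_imp_inj_on[OF bij], of j] by (simp add: x_def)
    have "\<exists>i<n. w $ i \<noteq> 0"
    proof (rule ccontr)
      assume "\<not> (\<exists>i<n. w $ i \<noteq> 0)"
      then have "w = 0\<^sub>v n" using w(1) by (intro eq_vecI) auto
      with w(2) show False by contradiction
    qed
    then obtain i where "i < n" "x (vs ! i) \<noteq> 0" using x by auto
    then have "\<exists>v\<in>verts G. x v \<noteq> 0" using nth_mem[of i vs] by (auto simp: n_def vset)
    moreover have "(\<Sum>v | v \<in> verts G \<and> (u, v) \<in> arcs_ends G. x v) = k * x u"
      if u: "u \<in> verts G" for u
    proof -
      obtain i where i: "i < n" "u = vs ! i" using u unfolding vset[symmetric] in_set_conv_nth n_def by auto
      show ?thesis using row[OF i(1) w(1) x] w(1,3) i x[of i] by simp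
    qed
    ultimately show ?R by blast
  next
    assume ?R
    then obtain x where x: "\<exists>v\<in>verts G. x v \<noteq> 0"
      "\<And>u. u \<in> verts G \<Longrightarrow> (\<Sum>v | v \<in> verts G \<and> (u, v) \<in> arcs_ends G. x v) = k * x u"
      by blast
    define w where "w = vec n (\<lambda>i. x (vs ! i))"
    have w: "w \<in> carrier_vec n" by (simp add: w_def)
    obtain i where i: "i < n" "x (vs ! i) \<noteq> 0"
      using x(1) unfolding vset[symmetric] Bex_def in_set_conv_nth n_def by auto
    then have "w $ i \<noteq> 0\<^sub>v n $ i" by (simp add: w_def)
    then have "w \<noteq> 0\<^sub>v n" by auto
    moreover have "?A *\<^sub>v w = k \<cdot>\<^sub>v w"
    proof (rule eq_vecI)
      fix i assume "i < dim_vec (k \<cdot>\<^sub>v w)"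
      then have i: "i < n" by (simp add: w_def)
      then have "vs ! i \<in> verts G" using nth_mem[of i vs] by (simp add: n_def vset)
      with i show "(?A *\<^sub>v w) $ i = (k \<cdot>\<^sub>v w) $ i"
        using row[OF i w, of x] x(2) by (simp add: w_def)
    qed (simp add: A w_def)
    ultimately show "eigenvalue ?A k"
      using w by (auto simp: eigenvalue_def eigenvector_def dim)
  qed
qed

end

theory Submission
  imports Defs "HOL-Analysis.Function_Topology" "HOL-Analysis.Convex"
begin

text \<open>
  The idea is to compare the entropy of a random homomorphism with the logarithm of the number of
  all homomorphisms. Let \<open>\<rho>\<close> be the spectral radius of \<open>G\<close>. If \<open>\<rho> = 0\<close>, there is nothing to do.
  Otherwise take a nonnegative unit eigenvector \<open>x\<close> for \<open>\<rho>\<close> and let \<open>W\<close> be its support. The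
  random walk on \<open>W\<close> that steps from \<open>a\<close> to a neighbour \<open>b\<close> with probability \<open>x b / (\<rho> * x a)\<close> is
  reversible with stationary distribution \<open>\<pi> = x\<^sup>2\<close>, and each step contributes exactly \<open>ln \<rho>\<close> to the
  entropy (by stationarity the contributions of \<open>x a\<close> and \<open>x b\<close> cancel on average). A tree arises from one vertex by attaching leaves
  (\<open>graph_tree_built_by_leaves\<close>), so one may map the first vertex according to \<open>\<pi>\<close> and every
  further vertex by one step of the walk from the image of its only earlier neighbour. The result is
  a random homomorphism of entropy \<open>H(\<pi>) + (l - 1) ln \<rho>\<close> (\<open>random_homomorphism\<close>), and as
  entropy is at most the logarithm of the number of outcomes,
  \<open>H(\<pi>) + (l - 1) ln \<rho> \<le> ln hom(T, G)\<close>.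

  It remains to see \<open>ln \<rho> \<le> H(\<pi>) + ln (1 - 1/r)\<close>, and this is where the clique number enters.
  A step of the stationary walk is a random arc with probabilities \<open>x a * x b / \<rho>\<close>. Comparing it by
  Gibbs' inequality with the weights \<open>\<pi> a * \<pi> b\<close> on the arcs gives
  \<open>ln \<rho> - H(\<pi>) \<le> ln (\<Sum> \<pi> a * \<pi> b)\<close>, the sum being over the arcs (\<open>ln_eigenvalue_le\<close>), and the
  theorem of Motzkin and Straus bounds this sum by \<open>1 - 1/r\<close>. Adding the two inequalities and
  exponentiating yields the claim.
\<close>

section \<open>Relative entropy\<close>

text \<open>
  Nonnegativity of relative entropy, for a weight \<open>q\<close> that need not be normalised: with \<open>q = 1\<close> it
  bounds an entropy by the logarithm of the number of outcomes. It is the tangent bound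
  \<open>ln t \<le> t - 1\<close>, averaged over \<open>p\<close>.
\<close>

lemma gibbs_inequality:
  fixes p q :: "'a \<Rightarrow> real"
  assumes "finite A" and p: "\<And>a. a \<in> A \<Longrightarrow> p a > 0" and q: "\<And>a. a \<in> A \<Longrightarrow> q a > 0"
    and total: "(\<Sum>a\<in>A. p a) = 1"
  shows "(\<Sum>a\<in>A. p a * (ln (q a) - ln (p a))) \<le> ln (\<Sum>a\<in>A. q a)"
proof -
  define Q where "Q = (\<Sum>a\<in>A. q a)"
  have "A \<noteq> {}" using total by auto
  then have Q: "Q > 0" unfolding Q_def using q \<open>finite A\<close> by (intro sum_pos)
  have "(\<Sum>a\<in>A. p a * (ln (q a) - ln (p a))) - ln Q
      = (\<Sum>a\<in>A. p a * (ln (q a) - ln (p a) - ln Q))"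
    using total by (simp add: right_diff_distrib sum_subtractf flip: sum_distrib_right)
  also have "\<dots> \<le> (\<Sum>a\<in>A. q a / Q - p a)"
  proof (rule sum_mono)
    fix a assume a: "a \<in> A"
    have "ln (q a) - ln (p a) - ln Q = ln (q a / (p a * Q))"
      using p[OF a] q[OF a] Q by (simp add: ln_div ln_mult)
    also have "\<dots> \<le> q a / (p a * Q) - 1"
      using p[OF a] q[OF a] Q by (intro ln_le_minus_one) simp
    finally have "p a * (ln (q a) - ln (p a) - ln Q) \<le> p a * (q a / (p a * Q) - 1)"
      using p[OF a] by (intro mult_left_mono) auto
    also have "\<dots> = q a / Q - p a"
      using p[OF a] Q by (simp add: field_simps)
    finally show "p a * (ln (q a) - ln (p a) - ln Q) \<le> q a / Q - p a" .
  qed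
  also have "\<dots> = 0"
    using total Q by (simp add: sum_subtractf Q_def flip: sum_divide_distrib)
  finally show ?thesis by (simp add: Q_def)
qed

section \<open>The adjacency form\<close>

definition adjacency_form :: "('a \<times> 'a) set \<Rightarrow> 'a set \<Rightarrow> ('a \<Rightarrow> real) \<Rightarrow> ('a \<Rightarrow> real) \<Rightarrow> real" where
  "adjacency_form E V x y = (\<Sum>u\<in>V. \<Sum>v\<in>V. of_bool ((u, v) \<in> E) * (x u * y v))"

lemma adjacency_form_commute:
  assumes "sym E"
  shows "adjacency_form E V x y = adjacency_form E V y x"
  unfolding adjacency_form_def
  by (subst sum.swap, intro sum.cong refl) (use assms in \<open>auto simp: sym_def\<close>)

lemma adjacency_form_add_scaled:
  assumes "sym E"
  shows "adjacency_form E V (\<lambda>v. x v + t * z v) (\<lambda>v. x v + t * z v) =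
    adjacency_form E V x x + 2 * t * adjacency_form E V z x + t\<^sup>2 * adjacency_form E V z z"
proof -
  have "adjacency_form E V (\<lambda>v. x v + t * z v) (\<lambda>v. x v + t * z v) =
    adjacency_form E V x x + t * adjacency_form E V x z + t * adjacency_form E V z x
      + t\<^sup>2 * adjacency_form E V z z"
    unfolding adjacency_form_def sum_distrib_left sum.distrib[symmetric]
    by (intro sum.cong refl) (simp add: algebra_simps power2_eq_square)
  then show ?thesis using adjacency_form_commute[OF assms, of V x z] by simp
qed

text \<open>
  The part of the form that involves one vertex \<open>a\<close> is linear in \<open>x a\<close>, because \<open>a\<close> carries no
  loop; the inductive proof of the Motzkin--Straus inequality rests on this.
\<close>

lemma adjacency_form_insert:
  assumes "finite V" "a \<notin> V" "sym E" "(a, a) \<notin> E"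
  shows "adjacency_form E (insert a V) x x =
    adjacency_form E V x x + 2 * (x a * (\<Sum>v\<in>V. of_bool ((a, v) \<in> E) * x v))"
proof -
  have "(\<Sum>v\<in>V. of_bool ((v, a) \<in> E) * (x v * x a)) = x a * (\<Sum>v\<in>V. of_bool ((a, v) \<in> E) * x v)"
    "(\<Sum>v\<in>V. of_bool ((a, v) \<in> E) * (x a * x v)) = x a * (\<Sum>v\<in>V. of_bool ((a, v) \<in> E) * x v)"
    unfolding sum_distrib_left
    by (intro sum.cong refl; use \<open>sym E\<close> in \<open>auto simp: sym_def\<close>)+
  then show ?thesis
    using assms
    by (simp add: adjacency_form_def sum.distrib
        del: sum_of_bool_mult_eq sum_mult_of_bool_eq)
qed

section \<open>The Motzkin--Straus inequality\<close>

text \<open>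
  For weights on a clique the form is at most \<open>1 - \<Sum> (y v)\<^sup>2\<close>, and by Cauchy--Schwarz the sum of squares
  is at least the reciprocal of the number of vertices.
\<close>

lemma motzkin_straus_clique:
  assumes "finite S" and nonneg: "\<And>v. v \<in> S \<Longrightarrow> y v \<ge> 0" and total: "(\<Sum>v\<in>S. y v) = (1::real)"
    and "card S \<le> r" and irr: "irrefl E"
  shows "adjacency_form E S y y \<le> 1 - 1 / real r"
proof -
  have "S \<noteq> {}" using total by auto
  then have c: "0 < card S" using \<open>finite S\<close> by (simp add: card_gt_0_iff)
  have sq: "1 \<le> (\<Sum>v\<in>S. (y v)\<^sup>2) * real (card S)"
    using sum_squared_le_sum_of_squares[of y S] \<open>finite S\<close> total by (simp add: mult.commute)
  have "adjacency_form E S y y \<le> (\<Sum>u\<in>S. \<Sum>v\<in>S. y u * y v - (if v = u then (y u)\<^sup>2 else 0))"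
    unfolding adjacency_form_def
    using irr nonneg by (intro sum_mono) (auto simp: irrefl_def power2_eq_square)
  also have "\<dots> = 1 - (\<Sum>v\<in>S. (y v)\<^sup>2)"
    using \<open>finite S\<close> total
    by (simp add: sum_subtractf sum.delta flip: sum_distrib_left sum_distrib_right)
  also have "\<dots> \<le> 1 - 1 / real (card S)"
    using sq c by (simp add: field_simps)
  also have "\<dots> \<le> 1 - 1 / real r"
    using c \<open>card S \<le> r\<close> by (simp add: frac_le)
  finally show ?thesis .
qed

text \<open>
  Between two nonadjacent vertices the form is linear in the amount of weight moved from one to the
  other, so all the weight of the one with the smaller neighbourhood weight may be moved.
\<close>

lemma motzkin_straus_shift:
  assumes fin: "finite S" and ab: "a \<in> S" "b \<in> S" "a \<noteq> b" "(a, b) \<notin> E"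
    and "sym E" "irrefl E" and nonneg: "y b \<ge> (0::real)"
    and le: "(\<Sum>v\<in>S. of_bool ((b, v) \<in> E) * y v) \<le> (\<Sum>v\<in>S. of_bool ((a, v) \<in> E) * y v)"
  shows "adjacency_form E S y y \<le> adjacency_form E (S - {b}) (y(a := y a + y b)) (y(a := y a + y b))"
proof -
  define R where "R = S - {a, b}"
  define d where "d w = (\<Sum>v\<in>R. of_bool ((w, v) \<in> E) * y v)" for w
  define z where "z = y(a := y a + y b)"
  have S: "S = insert b (insert a R)" "S - {b} = insert a R" "finite R" "a \<notin> R" "b \<notin> R"
    using ab fin by (auto simp: R_def)
  have nonadj: "(a, b) \<notin> E" "(b, a) \<notin> E" "(a, a) \<notin> E" "(b, b) \<notin> E"
    using ab \<open>sym E\<close> \<open>irrefl E\<close> by (auto simp: sym_def irrefl_def)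
  have "d b \<le> d a" using le S ab nonadj by (simp add: d_def)
  then have "y b * d b \<le> y b * d a" using nonneg by (rule mult_left_mono)
  moreover have "adjacency_form E S y y = adjacency_form E R y y + 2 * (y a * d a) + 2 * (y b * d b)"
    using S ab nonadj \<open>sym E\<close> by (simp add: adjacency_form_insert d_def)
  moreover have "adjacency_form E (S - {b}) z z = adjacency_form E R y y + 2 * ((y a + y b) * d a)"
  proof -
    have "adjacency_form E R z z = adjacency_form E R y y"
      unfolding adjacency_form_def z_def by (intro sum.cong refl) (use S in auto)
    moreover have "(\<Sum>v\<in>R. of_bool ((a, v) \<in> E) * z v) = d a"
      unfolding d_def z_def by (intro sum.cong refl) (use S in auto)
    ultimately show ?thesis
      using S nonadj \<open>sym E\<close> by (simp add: adjacency_form_insert) (simp add: z_def)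
  qed
  ultimately show ?thesis by (simp add: z_def distrib_right)
qed

text \<open>
  As long as the vertex set is not a clique, shifting weight removes a vertex without decreasing
  the form.
\<close>

theorem motzkin_straus:
  assumes "finite S" and "\<And>v. v \<in> S \<Longrightarrow> y v \<ge> (0::real)" and "(\<Sum>v\<in>S. y v) = 1"
    and sym: "sym E" and irr: "irrefl E"
    and "\<And>C. C \<subseteq> S \<Longrightarrow> (\<forall>u\<in>C. \<forall>v\<in>C. u \<noteq> v \<longrightarrow> (u, v) \<in> E) \<Longrightarrow> card C \<le> r"
  shows "adjacency_form E S y y \<le> 1 - 1 / real r"
  using assms(1-3,6)
proof (induction "card S" arbitrary: S y rule: less_induct)
  case less
  note fin = less.prems(1) and nonneg = less.prems(2) and total = less.prems(3)
    and cliques = less.prems(4)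
  show ?case
  proof (cases "\<forall>u\<in>S. \<forall>v\<in>S. u \<noteq> v \<longrightarrow> (u, v) \<in> E")
    case True
    then have "card S \<le> r" using cliques by blast
    with fin nonneg total irr show ?thesis by (intro motzkin_straus_clique)
  next
    case False
    define d where "d w = (\<Sum>v\<in>S. of_bool ((w, v) \<in> E) * y v)" for w
    from False obtain a b where ab: "a \<in> S" "b \<in> S" "a \<noteq> b" "(a, b) \<notin> E" and le: "d b \<le> d a"
      using sym by (metis linear symE)
    define z where "z = y(a := y a + y b)"
    have "adjacency_form E S y y \<le> adjacency_form E (S - {b}) z z"
      unfolding z_def using ab fin sym irr nonneg le[unfolded d_def]
      by (intro motzkin_straus_shift) auto
    also have "\<dots> \<le> 1 - 1 / real r"
    proof (rule less.hyps)
      show "card (S - {b}) < card S" using ab fin by (intro psubset_card_mono) auto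
      show "z v \<ge> 0" if "v \<in> S - {b}" for v using that nonneg ab by (auto simp: z_def)
      have S: "S = insert b (insert a (S - {a, b}))" "S - {b} = insert a (S - {a, b})"
        using ab by auto
      have "(\<Sum>v\<in>S - {a, b}. z v) = (\<Sum>v\<in>S - {a, b}. y v)"
        by (intro sum.cong) (auto simp: z_def)
      moreover have "(\<Sum>v\<in>S. y v) = y b + (y a + (\<Sum>v\<in>S - {a, b}. y v))"
        by (subst S(1)) (use fin ab in simp)
      ultimately show "(\<Sum>v\<in>S - {b}. z v) = 1"
        unfolding S(2) using total fin by (simp add: z_def)
      show "card C \<le> r" if "C \<subseteq> S - {b}" "\<forall>u\<in>C. \<forall>v\<in>C. u \<noteq> v \<longrightarrow> (u, v) \<in> E" for C
        using that by (intro cliques) auto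
    qed (use fin in auto)
    finally show ?thesis .
  qed
qed

section \<open>A nonnegative leading eigenvector\<close>

text \<open>
  A leading eigenvector is found by maximising the Rayleigh quotient. Vectors are functions
  that vanish outside \<open>V\<close>, with the product topology, so that compactness comes from Tychonoff's
  theorem.
\<close>

lemma compact_nonneg_unit_vectors:
  assumes "finite V"
  shows "compact {x :: 'a \<Rightarrow> real. (\<forall>v. 0 \<le> x v) \<and> (\<forall>v. v \<notin> V \<longrightarrow> x v = 0) \<and> (\<Sum>v\<in>V. (x v)\<^sup>2) = 1}"
    (is "compact ?K")
proof -
  define B where "B = (\<Pi>\<^sub>E v\<in>UNIV. if v \<in> V then {0..1::real} else {0})"
  have "compactin (product_topology (\<lambda>_. euclidean) UNIV) B"
    unfolding B_def by (subst compactin_PiE) auto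
  then have "compact B" by (simp add: euclidean_product_topology)
  moreover have "closed {x :: 'a \<Rightarrow> real. (\<Sum>v\<in>V. (x v)\<^sup>2) = 1}"
    by (intro closed_Collect_eq continuous_intros continuous_on_product_coordinates)
  moreover have "?K = B \<inter> {x. (\<Sum>v\<in>V. (x v)\<^sup>2) = 1}"
  proof -
    have "x v \<le> 1" if "v \<in> V" "(\<Sum>v\<in>V. (x v)\<^sup>2) = 1" for x :: "'a \<Rightarrow> real" and v
    proof -
      have "(x v)\<^sup>2 \<le> 1" using member_le_sum[of v V "\<lambda>v. (x v)\<^sup>2"] that \<open>finite V\<close> by auto
      then show ?thesis using abs_le_square_iff[of "x v" 1] by simp
    qed
    moreover have "x \<in> B \<longleftrightarrow> (\<forall>v\<in>V. 0 \<le> x v \<and> x v \<le> 1) \<and> (\<forall>v. v \<notin> V \<longrightarrow> x v = 0)" for x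
      unfolding B_def PiE_iff by (auto split: if_splits)
    ultimately show ?thesis by auto (metis order_refl)
  qed
  ultimately show ?thesis by auto
qed

lemma quadratic_nonneg_imp_linear_zero:
  fixes c d :: real
  assumes "\<And>t. 2 * t * c \<le> t\<^sup>2 * d"
  shows "c = 0"
proof (rule ccontr)
  assume "c \<noteq> 0"
  \<comment> \<open>At \<open>t = c / k\<close> with \<open>k > d\<close> the linear term outweighs the quadratic one.\<close>
  define k where "k = \<bar>d\<bar> + 1"
  have k: "k > 0" "d < k" by (auto simp: k_def)
  have "2 * c\<^sup>2 * k \<le> c\<^sup>2 * d"
    using assms[of "c / k"] k by (simp add: field_simps power2_eq_square)
  also have "\<dots> < c\<^sup>2 * k" using \<open>c \<noteq> 0\<close> k by simp
  finally show False using k \<open>c \<noteq> 0\<close> by (simp add: mult_le_cancel_right2)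
qed

text \<open>
  Maximising over nonnegative unit vectors loses nothing: the adjacency matrix has nonnegative
  entries, so the form does not decrease when a vector is replaced by its absolute value.
\<close>

lemma nonneg_rayleigh_maximiser:
  assumes fin: "finite V" and "V \<noteq> {}"
  obtains x M where "\<forall>v. 0 \<le> x v" "(\<Sum>v\<in>V. (x v)\<^sup>2) = 1" "adjacency_form E V x x = M"
    "\<forall>z. adjacency_form E V z z \<le> M * (\<Sum>v\<in>V. (z v)\<^sup>2)"
proof -
  define K where "K = {x :: 'a \<Rightarrow> real. (\<forall>v. 0 \<le> x v) \<and> (\<forall>v. v \<notin> V \<longrightarrow> x v = 0) \<and> (\<Sum>v\<in>V. (x v)\<^sup>2) = 1}"
  obtain w where "w \<in> V" using \<open>V \<noteq> {}\<close> by auto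
  then have "(\<lambda>v. if v = w then 1 else 0) \<in> K"
    using fin by (auto simp: K_def if_distrib[of "\<lambda>c::real. c\<^sup>2"] cong: if_cong)
  moreover have "continuous_on K (\<lambda>x. adjacency_form E V x x)"
    unfolding adjacency_form_def
    by (intro continuous_intros continuous_on_subset[OF continuous_on_product_coordinates]) auto
  moreover have "compact K" unfolding K_def by (rule compact_nonneg_unit_vectors[OF fin])
  ultimately obtain x where x: "x \<in> K" "\<And>y. y \<in> K \<Longrightarrow> adjacency_form E V y y \<le> adjacency_form E V x x"
    using continuous_attains_sup[of K "\<lambda>x. adjacency_form E V x x"] by blast
  define M where "M = adjacency_form E V x x"
  have "adjacency_form E V z z \<le> M * (\<Sum>v\<in>V. (z v)\<^sup>2)" for z
  proof -
    define t where "t = (\<Sum>v\<in>V. (z v)\<^sup>2)"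
    have t0: "t \<ge> 0" by (simp add: t_def sum_nonneg)
    show ?thesis
    proof (cases "t = 0")
      case True
      then have "\<forall>v\<in>V. z v = 0" using fin by (simp add: t_def sum_nonneg_eq_0_iff)
      then show ?thesis by (simp add: adjacency_form_def)
    next
      case False
      with t0 have t: "t > 0" by simp
      define y where "y v = (if v \<in> V then \<bar>z v\<bar> / sqrt t else 0)" for v
      have y: "y \<in> K"
        using t by (simp add: K_def y_def power_divide flip: sum_divide_distrib) (simp add: t_def)
      have "adjacency_form E V z z \<le> adjacency_form E V (\<lambda>v. \<bar>z v\<bar>) (\<lambda>v. \<bar>z v\<bar>)"
        unfolding adjacency_form_def
        by (intro sum_mono mult_left_mono) (auto simp flip: abs_mult)
      also have "\<dots> = t * adjacency_form E V y y"
        unfolding adjacency_form_def sum_distrib_left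
        by (intro sum.cong refl) (use t in \<open>simp add: y_def field_simps\<close>)
      also have "\<dots> \<le> t * M" using x(2)[OF y] t by (simp add: M_def)
      finally show ?thesis by (simp add: t_def mult.commute)
    qed
  qed
  then show ?thesis using that[of x M] x(1) by (auto simp: K_def M_def)
qed

text \<open>
  The first-order condition at the maximum in the direction of the unit vector at \<open>u\<close> is the
  eigenvector equation at \<open>u\<close>.
\<close>

lemma rayleigh_maximiser_eigenvector:
  assumes fin: "finite V" and sym: "sym E"
    and unit: "(\<Sum>v\<in>V. (x v)\<^sup>2) = 1" and M: "adjacency_form E V x x = M"
    and max: "\<And>z. adjacency_form E V z z \<le> M * (\<Sum>v\<in>V. (z v)\<^sup>2)"
    and u: "u \<in> V"
  shows "(\<Sum>v\<in>V. of_bool ((u, v) \<in> E) * x v) = M * x u"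
proof -
  define e where "e v = (of_bool (v = u) :: real)" for v
  define s where "s = (\<Sum>v\<in>V. of_bool ((u, v) \<in> E) * x v)"
  have s: "adjacency_form E V e x = s"
  proof -
    have "adjacency_form E V e x = (\<Sum>w\<in>V. if w = u then s else 0)"
      unfolding adjacency_form_def e_def s_def by (intro sum.cong refl) auto
    then show ?thesis using fin u by simp
  qed
  have "2 * t * (s - M * x u) \<le> t\<^sup>2 * (M - adjacency_form E V e e)" for t
  proof -
    have "(\<Sum>v\<in>V. (x v + t * e v)\<^sup>2) = (\<Sum>v\<in>V. (x v)\<^sup>2) + (\<Sum>v\<in>V. if v = u then 2 * t * x u + t\<^sup>2 else 0)"
      unfolding sum.distrib[symmetric] e_def
      by (intro sum.cong refl) (auto simp: power2_sum power_mult_distrib)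
    then have "(\<Sum>v\<in>V. (x v + t * e v)\<^sup>2) = 1 + 2 * t * x u + t\<^sup>2"
      using fin u unit by simp
    then show ?thesis
      using max[of "\<lambda>v. x v + t * e v"] adjacency_form_add_scaled[OF sym, of V x t e] M s
      by (simp add: algebra_simps)
  qed
  then have "s - M * x u = 0" by (rule quadratic_nonneg_imp_linear_zero)
  then show ?thesis by (simp add: s_def)
qed

section \<open>Random homomorphisms of trees\<close>

inductive built_by_leaves :: "('a \<times> 'a) set \<Rightarrow> 'a set \<Rightarrow> bool" for E where
  single_vertex: "built_by_leaves E {v}"
| attach_leaf: "built_by_leaves E S \<Longrightarrow> u \<in> S \<Longrightarrow> v \<notin> S \<Longrightarrow> (u, v) \<in> E
    \<Longrightarrow> (\<And>w. w \<in> S \<Longrightarrow> (w, v) \<in> E \<Longrightarrow> w = u) \<Longrightarrow> built_by_leaves E (insert v S)"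

lemma built_by_leaves_finite: "built_by_leaves E S \<Longrightarrow> finite S \<and> S \<noteq> {}"
  by (induction rule: built_by_leaves.induct) auto

text \<open>
  The domain \<open>S\<close> grows with the tree, while the range \<open>W\<close> will be the support of an eigenvector. Maps
  are extensional on \<open>S\<close>, so that attaching a vertex \<open>v\<close> is the update \<open>f(v := b)\<close>.
\<close>

definition homs_on :: "('a \<times> 'a) set \<Rightarrow> 'a set \<Rightarrow> ('c \<times> 'c) set \<Rightarrow> 'c set \<Rightarrow> ('a \<Rightarrow> 'c) set" where
  "homs_on E S D W = {f \<in> S \<rightarrow>\<^sub>E W. \<forall>u\<in>S. \<forall>v\<in>S. (u, v) \<in> E \<longrightarrow> (f u, f v) \<in> D}"

lemma finite_homs_on:
  assumes "finite S" "finite W"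
  shows "finite (homs_on E S D W)"
proof (rule finite_subset)
  show "homs_on E S D W \<subseteq> S \<rightarrow>\<^sub>E W" by (auto simp: homs_on_def)
qed (use assms in \<open>simp add: finite_PiE\<close>)

lemma sum_homs_on_single:
  assumes "irrefl E"
  shows "(\<Sum>f\<in>homs_on E {v} D W. h f) = (\<Sum>a\<in>W. h (\<lambda>_\<in>{v}. a))"
proof -
  have "homs_on E {v} D W = (\<lambda>a. \<lambda>_\<in>{v}. a) ` W"
  proof (intro equalityI subsetI)
    fix f assume "f \<in> homs_on E {v} D W"
    then have f: "f v \<in> W" "f \<in> extensional {v}" by (auto simp: homs_on_def PiE_def)
    have "f = (\<lambda>_\<in>{v}. f v)" by (rule extensionalityI[OF f(2)]) auto
    with f(1) show "f \<in> (\<lambda>a. \<lambda>_\<in>{v}. a) ` W" by blast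
  qed (use assms in \<open>auto simp: homs_on_def irrefl_def PiE_iff\<close>)
  moreover have "inj_on (\<lambda>a. \<lambda>_\<in>{v}. a) W"
    by (rule inj_onI, drule fun_cong[of _ _ v]) simp
  ultimately show ?thesis by (simp add: sum.reindex)
qed

text \<open>
  A homomorphism of a graph with a leaf \<open>v\<close> at \<open>u\<close> is a homomorphism of the rest together with
  a neighbour of the image of \<open>u\<close>.
\<close>

lemma sum_homs_on_attach_leaf:
  assumes E: "sym E" "irrefl E" and "sym D" and fin: "finite S" "finite W"
    and u: "u \<in> S" "v \<notin> S" "(u, v) \<in> E" and leaf: "\<And>w. w \<in> S \<Longrightarrow> (w, v) \<in> E \<Longrightarrow> w = u"
  shows "(\<Sum>g\<in>homs_on E (insert v S) D W. h g) =
    (\<Sum>f\<in>homs_on E S D W. \<Sum>b | b \<in> W \<and> (f u, b) \<in> D. h (f(v := b)))"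
proof -
  let ?P = "SIGMA f : homs_on E S D W. {b. b \<in> W \<and> (f u, b) \<in> D}"
  have "homs_on E (insert v S) D W = (\<lambda>(f, b). f(v := b)) ` ?P"
  proof (intro equalityI subsetI)
    fix g assume g: "g \<in> homs_on E (insert v S) D W"
    have "g(v := undefined) \<in> homs_on E S D W"
      using g u by (auto simp: homs_on_def PiE_iff extensional_def)
    moreover have "g v \<in> W" "((g(v := undefined)) u, g v) \<in> D"
      using g u by (auto simp: homs_on_def)
    ultimately show "g \<in> (\<lambda>(f, b). f(v := b)) ` ?P"
      by (intro image_eqI[of _ _ "(g(v := undefined), g v)"]) auto
  next
    fix g assume "g \<in> (\<lambda>(f, b). f(v := b)) ` ?P"
    then obtain f b where g: "g = f(v := b)" and f: "f \<in> homs_on E S D W" and b: "b \<in> W" "(f u, b) \<in> D"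
      by auto
    have irr: "(v, v) \<notin> E" using E by (auto simp: irrefl_def)
    have leaf': "w = u" if "w \<in> S" "(v, w) \<in> E" for w
      using leaf that E by (meson symE)
    have bu: "(b, f u) \<in> D" using b \<open>sym D\<close> by (meson symE)
    have "(g c, g d) \<in> D" if cd: "c \<in> insert v S" "d \<in> insert v S" "(c, d) \<in> E" for c d
    proof -
      consider "c = v" "d \<in> S" | "c \<in> S" "d = v" | "c \<in> S" "d \<in> S" using cd irr by blast
      then show ?thesis
      proof cases
        case 1
        then show ?thesis using leaf'[of d] cd(3) bu u by (auto simp: g)
      next
        case 2
        then show ?thesis using leaf[of c] cd(3) b u by (auto simp: g)
      next
        case 3
        then show ?thesis using f cd(3) u by (auto simp: g homs_on_def)
      qed
    qed
    moreover have "g \<in> insert v S \<rightarrow>\<^sub>E W"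
      unfolding g using f b by (intro PiE_fun_upd) (simp_all add: homs_on_def)
    ultimately show "g \<in> homs_on E (insert v S) D W" unfolding homs_on_def by blast
  qed
  moreover have "inj_on (\<lambda>(f, b). f(v := b)) ?P"
  proof (intro inj_onI, clarsimp)
    fix f f' :: "'a \<Rightarrow> 'b" and b b'
    assume f: "f \<in> homs_on E S D W" "f' \<in> homs_on E S D W" and eq: "f(v := b) = f'(v := b')"
    have "f v = undefined" "f' v = undefined"
      using f u by (auto simp: homs_on_def PiE_iff extensional_def)
    then have "f w = f' w" for w
      using fun_cong[OF eq, of w] by (cases "w = v") auto
    moreover have "b = b'" using fun_cong[OF eq, of v] by simp
    ultimately show "f = f' \<and> b = b'" by auto
  qed
  moreover have "finite (homs_on E S D W)"
    using fin by (rule finite_homs_on)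
  ultimately show ?thesis
    using fin by (simp add: sum.reindex sum.Sigma case_prod_unfold)
qed

text \<open>
  The eigenvector is strictly positive on \<open>W\<close>, which will be its support. On \<open>W\<close> it defines the
  random walk with transition probabilities \<open>x b / (k * x a)\<close>.
\<close>

locale positive_eigenvector =
  fixes D :: "('c \<times> 'c) set" and W :: "'c set" and x :: "'c \<Rightarrow> real" and k :: real
  assumes finite_W: "finite W" and sym_D: "sym D"
    and x_pos: "a \<in> W \<Longrightarrow> x a > 0" and k_pos: "k > 0"
    and unit: "(\<Sum>a\<in>W. (x a)\<^sup>2) = 1"
    and eigen: "a \<in> W \<Longrightarrow> (\<Sum>b | b \<in> W \<and> (a, b) \<in> D. x b) = k * x a"
begin

definition vertex_entropy :: real where
  "vertex_entropy = - (\<Sum>a\<in>W. (x a)\<^sup>2 * ln ((x a)\<^sup>2))"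

lemma vertex_entropy_eq: "(\<Sum>a\<in>W. (x a)\<^sup>2 * ln (x a)) = - vertex_entropy / 2"
proof -
  have "(\<Sum>a\<in>W. (x a)\<^sup>2 * ln ((x a)\<^sup>2)) = (\<Sum>a\<in>W. 2 * ((x a)\<^sup>2 * ln (x a)))"
    by (intro sum.cong refl) (simp add: x_pos ln_realpow)
  then show ?thesis by (simp add: vertex_entropy_def flip: sum_distrib_left)
qed

lemma transition_total:
  assumes "a \<in> W"
  shows "(\<Sum>b | b \<in> W \<and> (a, b) \<in> D. x b / (k * x a)) = 1"
  using eigen[OF assms] x_pos[OF assms] k_pos by (simp flip: sum_divide_distrib)

text \<open>
  The walk passes along \<open>(a, b)\<close> with probability \<open>x a * x b / k\<close>, which is symmetric in \<open>a\<close> and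
  \<open>b\<close>; hence \<open>x\<^sup>2\<close> is stationary. Stationarity is stated through expectations of an arbitrary
  function \<open>g\<close>, the form in which marginals are used below.
\<close>

lemma transition_stationary:
  "(\<Sum>a\<in>W. (x a)\<^sup>2 * (\<Sum>b | b \<in> W \<and> (a, b) \<in> D. x b / (k * x a) * g b)) = (\<Sum>a\<in>W. (x a)\<^sup>2 * g a)"
proof -
  have "(\<Sum>a\<in>W. (x a)\<^sup>2 * (\<Sum>b | b \<in> W \<and> (a, b) \<in> D. x b / (k * x a) * g b))
      = (\<Sum>a\<in>W. \<Sum>b | b \<in> W \<and> (a, b) \<in> D. x a * x b * g b / k)"
    unfolding sum_distrib_left
    by (intro sum.cong refl) (use x_pos k_pos in \<open>auto simp: field_simps power2_eq_square\<close>)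
  also have "\<dots> = (\<Sum>b\<in>W. \<Sum>a | a \<in> W \<and> (a, b) \<in> D. x a * x b * g b / k)"
    by (rule sum.swap_restrict[OF finite_W finite_W])
  also have "\<dots> = (\<Sum>b\<in>W. x b * g b / k * (\<Sum>a | a \<in> W \<and> (b, a) \<in> D. x a))"
    unfolding sum_distrib_left
    by (intro sum.cong refl) (use sym_D in \<open>auto simp: sym_def\<close>)
  also have "\<dots> = (\<Sum>b\<in>W. (x b)\<^sup>2 * g b)"
    using k_pos by (intro sum.cong refl) (simp add: eigen power2_eq_square)
  finally show ?thesis .
qed

text \<open>
  When a leaf \<open>v\<close> is attached at \<open>u\<close>, its image is chosen by one step of the walk from the image
  of \<open>u\<close>. By stationarity all vertices, old and new, have an image distributed like \<open>x\<^sup>2\<close>.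
  Therefore the expectations of \<open>ln (x (f v))\<close> and \<open>ln (x (f u))\<close> are equal, and in the
  expected logarithm of the transition probability \<open>x (f v) / (k * x (f u))\<close> only \<open>- ln k\<close> is left.
\<close>

lemma random_homomorphism:
  assumes "built_by_leaves E S" "sym E" "irrefl E"
  shows "\<exists>p. (\<forall>f\<in>homs_on E S D W. p f > 0) \<and>
    (\<forall>w\<in>S. \<forall>g. (\<Sum>f\<in>homs_on E S D W. p f * g (f w)) = (\<Sum>a\<in>W. (x a)\<^sup>2 * g a)) \<and>
    (\<Sum>f\<in>homs_on E S D W. p f * ln (p f)) = - (vertex_entropy + (real (card S) - 1) * ln k)"
  using assms
proof (induction rule: built_by_leaves.induct)
  case (single_vertex v)
  define p where "p f = (x (f v))\<^sup>2" for f :: "_ \<Rightarrow> 'c"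
  have "p f > 0" if "f \<in> homs_on E {v} D W" for f
    using that x_pos[of "f v"] PiE_mem[of f "{v}" "\<lambda>_. W" v] by (simp add: homs_on_def p_def)
  moreover have "(\<Sum>f\<in>homs_on E {v} D W. p f * g (f v)) = (\<Sum>a\<in>W. (x a)\<^sup>2 * g a)" for g
    by (simp add: sum_homs_on_single[OF single_vertex(2)] p_def)
  moreover have "(\<Sum>f\<in>homs_on E {v} D W. p f * ln (p f)) = - vertex_entropy"
    by (simp add: sum_homs_on_single[OF single_vertex(2)] p_def vertex_entropy_def)
  ultimately show ?case by (intro exI[of _ p] conjI ballI allI) simp_all
next
  case (attach_leaf S u v)
  from attach_leaf.IH[OF attach_leaf.prems] obtain p where
    pos: "\<And>f. f \<in> homs_on E S D W \<Longrightarrow> p f > 0" and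
    marg: "\<And>w g. w \<in> S \<Longrightarrow> (\<Sum>f\<in>homs_on E S D W. p f * g (f w)) = (\<Sum>a\<in>W. (x a)\<^sup>2 * g a)" and
    ent: "(\<Sum>f\<in>homs_on E S D W. p f * ln (p f)) = - (vertex_entropy + (real (card S) - 1) * ln k)"
    by blast
  have fin: "finite S" using built_by_leaves_finite[OF attach_leaf.hyps(1)] by simp
  have split: "(\<Sum>g\<in>homs_on E (insert v S) D W. h g) =
      (\<Sum>f\<in>homs_on E S D W. \<Sum>b | b \<in> W \<and> (f u, b) \<in> D. h (f(v := b)))" for h :: "_ \<Rightarrow> real"
    using attach_leaf.prems sym_D fin finite_W attach_leaf.hyps(2-5)
    by (rule sum_homs_on_attach_leaf)
  \<comment> \<open>Extensional maps on \<open>S\<close> are undefined at \<open>v\<close>, so \<open>g(v := undefined)\<close> is the restriction of \<open>g\<close> to \<open>S\<close>.\<close>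
  define q where "q g = p (g(v := undefined)) * (x (g v) / (k * x (g u)))" for g
  have f: "f u \<in> W" "f v = undefined" if "f \<in> homs_on E S D W" for f
    using that attach_leaf.hyps(2,3) by (auto simp: homs_on_def PiE_iff extensional_def)
  have uv: "u \<noteq> v" using attach_leaf.hyps(2,3) by auto
  have q: "q (f(v := b)) = p f * (x b / (k * x (f u)))" if "f \<in> homs_on E S D W" for f b
    using uv fun_upd_triv[of f v] by (simp add: q_def f(2)[OF that])
  have q_sum: "(\<Sum>g\<in>homs_on E (insert v S) D W. q g * h g) =
      (\<Sum>f\<in>homs_on E S D W. p f * (\<Sum>b | b \<in> W \<and> (f u, b) \<in> D. x b / (k * x (f u)) * h (f(v := b))))" for h
    unfolding split sum_distrib_left by (intro sum.cong refl) (simp add: q)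
  have marg_old: "(\<Sum>g\<in>homs_on E (insert v S) D W. q g * h (g w)) = (\<Sum>a\<in>W. (x a)\<^sup>2 * h a)"
    if "w \<in> S" for w h
  proof -
    have "w \<noteq> v" using that attach_leaf.hyps(2,3) by auto
    then have "(\<Sum>g\<in>homs_on E (insert v S) D W. q g * h (g w)) = (\<Sum>f\<in>homs_on E S D W. p f * h (f w))"
      unfolding q_sum
      by (intro sum.cong refl)
        (simp only: fun_upd_other not_False_eq_True sum_distrib_right[symmetric] transition_total f(1) mult_1)
    then show ?thesis using marg[OF that] by simp
  qed
  have marg_new: "(\<Sum>g\<in>homs_on E (insert v S) D W. q g * h (g v)) = (\<Sum>a\<in>W. (x a)\<^sup>2 * h a)" for h
    unfolding q_sum
    using marg[OF \<open>u \<in> S\<close>, of "\<lambda>a. \<Sum>b | b \<in> W \<and> (a, b) \<in> D. x b / (k * x a) * h b"]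
    by (simp only: transition_stationary fun_upd_same)
  have mem: "g(v := undefined) \<in> homs_on E S D W" "g v \<in> W" "g u \<in> W"
    if "g \<in> homs_on E (insert v S) D W" for g
    using that attach_leaf.hyps(2,3) by (auto simp: homs_on_def PiE_iff extensional_def)
  have q_pos: "q g > 0" if "g \<in> homs_on E (insert v S) D W" for g
    using mem[OF that] pos x_pos k_pos by (simp add: q_def)
  have "(\<Sum>g\<in>homs_on E (insert v S) D W. q g * ln (q g)) =
    (\<Sum>g\<in>homs_on E (insert v S) D W. q g * ln (p (g(v := undefined))) + q g * ln (x (g v))
      - q g * ln k - q g * ln (x (g u)))"
  proof (intro sum.cong refl)
    fix g assume g: "g \<in> homs_on E (insert v S) D W"
    have "ln (q g) = ln (p (g(v := undefined))) + ln (x (g v)) - ln k - ln (x (g u))"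
      using mem[OF g] pos[OF mem(1)[OF g]] x_pos[OF mem(2)[OF g]] x_pos[OF mem(3)[OF g]] k_pos
      by (simp add: q_def ln_mult ln_div)
    then show "q g * ln (q g) = q g * ln (p (g(v := undefined))) + q g * ln (x (g v)) - q g * ln k - q g * ln (x (g u))"
      by (simp add: distrib_left right_diff_distrib)
  qed
  also have "\<dots> = (\<Sum>g\<in>homs_on E (insert v S) D W. q g * ln (p (g(v := undefined)))) - ln k"
    using marg_new[of "\<lambda>a. ln (x a)"] marg_old[OF \<open>u \<in> S\<close>, of "\<lambda>a. ln (x a)"]
      marg_new[of "\<lambda>_. ln k"] unit
    by (simp add: sum.distrib sum_subtractf flip: sum_distrib_right)
  also have "(\<Sum>g\<in>homs_on E (insert v S) D W. q g * ln (p (g(v := undefined)))) =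
      (\<Sum>f\<in>homs_on E S D W. p f * ln (p f))"
    unfolding q_sum
  proof (intro sum.cong refl)
    fix f' assume f': "f' \<in> homs_on E S D W"
    have "f'(v := undefined) = f'" using f(2)[OF f'] fun_upd_triv[of f' v] by simp
    then show "p f' * (\<Sum>b | b \<in> W \<and> (f' u, b) \<in> D. x b / (k * x (f' u)) * ln (p (f'(v := b, v := undefined)))) = p f' * ln (p f')"
      by (simp only: fun_upd_upd sum_distrib_right[symmetric] transition_total[OF f(1)[OF f']] mult_1)
  qed
  finally have q_ent: "(\<Sum>g\<in>homs_on E (insert v S) D W. q g * ln (q g)) =
      - (vertex_entropy + (real (card (insert v S)) - 1) * ln k)"
    using ent fin \<open>v \<notin> S\<close> by (simp add: algebra_simps)
  show ?case
  proof (intro exI[of _ q] conjI ballI allI)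
    fix w h assume "w \<in> insert v S"
    then show "(\<Sum>g\<in>homs_on E (insert v S) D W. q g * h (g w)) = (\<Sum>a\<in>W. (x a)\<^sup>2 * h a)"
      using marg_old[of w h] marg_new[of h] by (cases "w = v") (simp_all only: insert_iff simp_thms)
  qed (rule q_pos q_ent, assumption?)+
qed

lemma entropy_le_ln_card_homs:
  assumes "built_by_leaves E S" "sym E" "irrefl E"
  shows "homs_on E S D W \<noteq> {}"
    and "vertex_entropy + (real (card S) - 1) * ln k \<le> ln (card (homs_on E S D W))"
proof -
  obtain p where
    pos: "\<And>f. f \<in> homs_on E S D W \<Longrightarrow> p f > 0" and
    marg: "\<And>w g. w \<in> S \<Longrightarrow> (\<Sum>f\<in>homs_on E S D W. p f * g (f w)) = (\<Sum>a\<in>W. (x a)\<^sup>2 * g a)" and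
    ent: "(\<Sum>f\<in>homs_on E S D W. p f * ln (p f)) = - (vertex_entropy + (real (card S) - 1) * ln k)"
    using random_homomorphism[OF assms] by blast
  have S: "finite S" "S \<noteq> {}" using built_by_leaves_finite[OF assms(1)] by auto
  then have total: "(\<Sum>f\<in>homs_on E S D W. p f) = 1"
    using marg[of _ "\<lambda>_. 1"] unit by auto
  then show "homs_on E S D W \<noteq> {}" by auto
  have "finite (homs_on E S D W)"
    using S finite_W by (intro finite_homs_on)
  from this pos have "(\<Sum>f\<in>homs_on E S D W. p f * (ln 1 - ln (p f))) \<le> ln (\<Sum>f\<in>homs_on E S D W. 1)"
    using total by (intro gibbs_inequality) auto
  moreover have "(\<Sum>f\<in>homs_on E S D W. p f * (ln 1 - ln (p f))) = - (\<Sum>f\<in>homs_on E S D W. p f * ln (p f))"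
    by (simp add: sum_negf)
  ultimately show "vertex_entropy + (real (card S) - 1) * ln k \<le> ln (card (homs_on E S D W))"
    using ent by simp
qed

text \<open>
  Gibbs' inequality on the arcs inside \<open>W\<close>, with the arc distribution \<open>p\<close> of the stationary walk
  against the product weights \<open>q\<close>. Here \<open>q / p = k * x a * x b\<close>, whose expected logarithm is
  \<open>ln k\<close> minus the entropy, because both marginals of \<open>p\<close> are \<open>x\<^sup>2\<close>.
\<close>

lemma
  shows stationary_form_pos: "adjacency_form D W (\<lambda>a. (x a)\<^sup>2) (\<lambda>a. (x a)\<^sup>2) > 0"
    and ln_eigenvalue_le:
      "ln k \<le> vertex_entropy + ln (adjacency_form D W (\<lambda>a. (x a)\<^sup>2) (\<lambda>a. (x a)\<^sup>2))"
proof -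
  define A where "A = (SIGMA a : W. {b. b \<in> W \<and> (a, b) \<in> D})"
  define p where "p = (\<lambda>(a, b). x a * x b / k)"
  define q where "q = (\<lambda>(a, b). (x a)\<^sup>2 * (x b)\<^sup>2)"
  have finA: "finite A" using finite_W by (simp add: A_def)
  have sum_A: "(\<Sum>e\<in>A. h e) = (\<Sum>a\<in>W. \<Sum>b | b \<in> W \<and> (a, b) \<in> D. h (a, b))" for h :: "_ \<Rightarrow> real"
    using finite_W by (simp add: A_def sum.Sigma)
  have p_eq: "p (a, b) = (x a)\<^sup>2 * (x b / (k * x a))" if "a \<in> W" for a b
    using x_pos[OF that] k_pos by (simp add: p_def power2_eq_square)
  have fst_marg: "(\<Sum>e\<in>A. p e * h (fst e)) = (\<Sum>a\<in>W. (x a)\<^sup>2 * h a)" for h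
  proof -
    have "(\<Sum>e\<in>A. p e * h (fst e)) = (\<Sum>a\<in>W. (x a)\<^sup>2 * h a * (\<Sum>b | b \<in> W \<and> (a, b) \<in> D. x b / (k * x a)))"
      unfolding sum_A sum_distrib_left by (intro sum.cong refl) (simp add: p_eq)
    then show ?thesis by (simp add: transition_total)
  qed
  have snd_marg: "(\<Sum>e\<in>A. p e * h (snd e)) = (\<Sum>a\<in>W. (x a)\<^sup>2 * h a)" for h
    unfolding sum_A transition_stationary[symmetric] sum_distrib_left
    by (intro sum.cong refl) (simp add: p_eq)
  have "(\<Sum>e\<in>A. p e * (ln (q e) - ln (p e))) = (\<Sum>e\<in>A. p e * ln k + p e * ln (x (fst e)) + p e * ln (x (snd e)))"
  proof (intro sum.cong refl)
    fix e assume "e \<in> A"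
    then have "x (fst e) > 0" "x (snd e) > 0" by (auto simp: A_def x_pos)
    then have "ln (q e) - ln (p e) = ln k + ln (x (fst e)) + ln (x (snd e))"
      using k_pos by (simp add: p_def q_def case_prod_unfold ln_mult ln_div ln_realpow)
    then show "p e * (ln (q e) - ln (p e)) = p e * ln k + p e * ln (x (fst e)) + p e * ln (x (snd e))"
      by (simp add: distrib_left)
  qed
  also have "\<dots> = ln k - vertex_entropy"
    using fst_marg[of "\<lambda>_. ln k"] fst_marg[of "\<lambda>a. ln (x a)"] snd_marg[of "\<lambda>a. ln (x a)"] unit
    by (simp add: sum.distrib vertex_entropy_eq flip: sum_distrib_right)
  finally have "(\<Sum>e\<in>A. p e * (ln (q e) - ln (p e))) = ln k - vertex_entropy" .
  moreover have q_sum: "(\<Sum>e\<in>A. q e) = adjacency_form D W (\<lambda>a. (x a)\<^sup>2) (\<lambda>a. (x a)\<^sup>2)"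
    unfolding sum_A adjacency_form_def
    unfolding q_def prod.case
    by (intro sum.cong refl sum.mono_neutral_cong_left) (use finite_W in auto)
  moreover have total: "(\<Sum>e\<in>A. p e) = 1" using fst_marg[of "\<lambda>_. 1"] unit by simp
  have p_pos: "p e > 0" and q_pos: "q e > 0" if "e \<in> A" for e
    using that x_pos[of "fst e"] x_pos[of "snd e"] k_pos by (auto simp: A_def p_def q_def)
  have "(\<Sum>e\<in>A. p e * (ln (q e) - ln (p e))) \<le> ln (\<Sum>e\<in>A. q e)"
    using finA p_pos q_pos total by (rule gibbs_inequality)
  ultimately show "ln k \<le> vertex_entropy + ln (adjacency_form D W (\<lambda>a. (x a)\<^sup>2) (\<lambda>a. (x a)\<^sup>2))"
    by simp
  have "A \<noteq> {}" using total by auto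
  then show "adjacency_form D W (\<lambda>a. (x a)\<^sup>2) (\<lambda>a. (x a)\<^sup>2) > 0"
    using finA q_pos unfolding q_sum[symmetric] by (intro sum_pos) auto
qed

end

section \<open>Trees are built by attaching leaves\<close>

lemma (in pre_digraph) set_awalk_verts_heads:
  "cas u p w \<Longrightarrow> set (awalk_verts u p) = insert u (head G ` set p)"
  by (induction p arbitrary: u) auto

text \<open>
  A path inside \<open>S\<close> is needed, since only then does a vertex outside \<open>S\<close> with two neighbours in
  \<open>S\<close> close a cycle. Shortcutting a walk to a path uses no new arcs, so it suffices to
  follow the heads of the arcs.
\<close>

lemma path_inside:
  assumes "wf_digraph T" and "S \<subseteq> verts T"
    and "(u, w) \<in> (arcs_ends T \<inter> S \<times> S)\<^sup>*" and "w \<in> S"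
  shows "\<exists>p. pre_digraph.apath T u p w \<and> set (pre_digraph.awalk_verts T u p) \<subseteq> S"
proof -
  interpret wf_digraph T by fact
  have "\<exists>p. awalk u p w \<and> head T ` set p \<subseteq> S \<and> u \<in> S"
    using assms(3)
  proof (induction rule: converse_rtrancl_induct)
    case base
    show ?case using assms by (intro exI[of _ "[]"]) (auto simp: awalk_Nil_iff)
  next
    case (step a b)
    then obtain p e where "awalk b p w" "head T ` set p \<subseteq> S" "a \<in> S" "b \<in> S"
      "e \<in> arcs T" "tail T e = a" "head T e = b" by auto
    then show ?case by (intro exI[of _ "e # p"]) (auto simp: awalk_Cons_iff)
  qed
  then obtain p where p: "awalk u p w" "head T ` set p \<subseteq> S" "u \<in> S" by blast
  let ?q = "awalk_to_apath p"
  have q: "apath u ?q w" using p(1) by (rule apath_awalk_to_apath)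
  then have "cas u ?q w" by (simp add: apath_def awalk_def)
  then have "set (awalk_verts u ?q) = insert u (head T ` set ?q)" by (rule set_awalk_verts_heads)
  also have "\<dots> \<subseteq> S" using p awalk_to_apath_subset[OF p(1)] by blast
  finally show ?thesis using q by blast
qed

text \<open>
  Two neighbours \<open>u \<noteq> w\<close> of \<open>v\<close> in \<open>S\<close> would give, together with a path from \<open>u\<close> to \<open>w\<close> inside
  \<open>S\<close>, a cycle through \<open>v\<close> with at least three arcs.
\<close>

lemma graph_tree_unique_attachment:
  assumes T: "graph_tree T" and S: "S \<subseteq> verts T" "u \<in> S" "w \<in> S" "v \<notin> S"
    and uv: "(u, v) \<in> arcs_ends T" and wv: "(w, v) \<in> arcs_ends T"
    and conn: "(u, w) \<in> (arcs_ends T \<inter> S \<times> S)\<^sup>*"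
  shows "w = u"
proof (rule ccontr)
  assume "w \<noteq> u"
  interpret graph T using T by (simp add: graph_tree_def)
  obtain p where p: "apath u p w" "set (awalk_verts u p) \<subseteq> S"
    using path_inside[OF wf_digraph S(1) conn] S by blast
  have "(v, u) \<in> arcs_ends T" using uv sym_arcs by (auto dest: arcs_ends_symmetric)
  then obtain e where e: "e \<in> arcs T" "tail T e = v" "head T e = u" by auto
  obtain e' where e': "e' \<in> arcs T" "tail T e' = w" "head T e' = v" using wv by auto
  have walk: "awalk v (e # p @ [e']) v"
    using p(1) e e' by (auto simp: awalk_Cons_iff apath_def awalk_append_iff awalk_Nil_iff)
  have "awalk_verts v (e # p @ [e']) = v # awalk_verts u p @ [v]"
    using p(1) e e' walk by (auto simp: apath_def awalk_verts_append awalk_Cons_iff)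
  then have "cycle (e # p @ [e'])"
    using walk p S unfolding cycle_def by (intro exI[of _ v]) (auto simp: apath_def)
  moreover have "p \<noteq> []" using p(1) \<open>w \<noteq> u\<close> by (auto simp: apath_Nil_iff)
  then have "3 \<le> length (e # p @ [e'])" by (cases p) auto
  ultimately show False using T by (auto simp: graph_tree_def)
qed

text \<open>
  A largest internally connected vertex set that is built by attaching leaves must contain all
  vertices: otherwise, by connectedness of the tree, some arc leads out of it, and its end is a leaf
  over the set.
\<close>

lemma graph_tree_built_by_leaves:
  assumes T: "graph_tree T"
  shows "built_by_leaves (arcs_ends T) (verts T)"
proof -
  interpret graph T using T by (simp add: graph_tree_def)
  let ?E = "arcs_ends T"
  have symE: "sym ?E" using sym_arcs by (simp add: symmetric_def)
  define good where "good S \<longleftrightarrow> S \<subseteq> verts T \<and> built_by_leaves ?E S \<and>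
      (\<forall>u\<in>S. \<forall>w\<in>S. (u, w) \<in> (?E \<inter> S \<times> S)\<^sup>*)" for S
  have reach: "(u, w) \<in> ?E\<^sup>*" if "u \<in> verts T" "w \<in> verts T" for u w
  proof -
    have "u \<rightarrow>\<^sup>*\<^bsub>mk_symmetric T\<^esub> w"
      using T that unfolding graph_tree_def Digraph_Component.connected_def strongly_connected_def by simp
    then have "u \<rightarrow>\<^sup>*\<^bsub>T\<^esub> w" by (simp only: reachable_mk_symmetric_eq[OF sym_arcs])
    then show ?thesis by (rule reachable_rtranclI)
  qed
  \<comment> \<open>Connectedness inside \<open>S\<close> is carried along because the uniqueness of the attachment needs it.\<close>
  have grow: "\<exists>S'. good S' \<and> card S < card S'" if S: "good S" "S \<noteq> verts T" for S
  proof -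
    from S have sub: "S \<subseteq> verts T" and built: "built_by_leaves ?E S"
      and conn: "\<And>u w. u \<in> S \<Longrightarrow> w \<in> S \<Longrightarrow> (u, w) \<in> (?E \<inter> S \<times> S)\<^sup>*"
      by (auto simp: good_def)
    have fin: "finite S" "S \<noteq> {}" using built_by_leaves_finite[OF built] by auto
    then obtain s t where st: "s \<in> S" "t \<in> verts T" "t \<notin> S" using S sub by auto
    have "\<exists>u\<in>S. \<exists>v. v \<notin> S \<and> (u, v) \<in> ?E"
    proof (rule ccontr)
      assume closed: "\<not> ?thesis"
      have "(s, t) \<in> ?E\<^sup>*" using reach st sub by blast
      then have "t \<in> S" using st(1) closed by (induction rule: rtrancl_induct) blast+
      with st show False by simp
    qed
    then obtain u v where uv: "u \<in> S" "v \<notin> S" "(u, v) \<in> ?E" by blast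
    have v: "v \<in> verts T" using uv adj_in_verts by blast
    have unique: "w = u" if "w \<in> S" "(w, v) \<in> ?E" for w
      using graph_tree_unique_attachment[OF T sub uv(1) that(1) uv(2,3) that(2) conn] uv that by blast
    let ?S' = "insert v S"
    have "built_by_leaves ?E ?S'" using built uv unique by (rule built_by_leaves.attach_leaf)
    moreover have "(a, b) \<in> (?E \<inter> ?S' \<times> ?S')\<^sup>*" if "a \<in> ?S'" "b \<in> ?S'" for a b
    proof -
      let ?R = "?E \<inter> ?S' \<times> ?S'"
      have old: "(a, b) \<in> ?R\<^sup>*" if "a \<in> S" "b \<in> S" for a b
        using conn[OF that] rtrancl_mono[of "?E \<inter> S \<times> S" ?R] by auto
      have to_v: "(u, v) \<in> ?R" "(v, u) \<in> ?R" using uv symE by (auto simp: sym_def)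
      show ?thesis
        using that old uv(1) to_v
        by (auto intro: rtrancl_into_rtrancl converse_rtrancl_into_rtrancl)
    qed
    ultimately have "good ?S'" using sub v by (auto simp: good_def)
    then show ?thesis using fin uv by (intro exI[of _ ?S']) auto
  qed
  have "verts T \<noteq> {}"
    using T unfolding graph_tree_def Digraph_Component.connected_def strongly_connected_def by simp
  then obtain v where "v \<in> verts T" by auto
  then have "good {v}" by (auto simp: good_def intro: built_by_leaves.single_vertex)
  moreover have "\<forall>S. good S \<longrightarrow> card S < card (verts T) + 1"
    by (auto simp: good_def less_Suc_eq_le intro: card_mono)
  ultimately obtain S where S: "good S" "\<And>S'. good S' \<Longrightarrow> card S' \<le> card S"
    using ex_has_greatest_nat[of good "{v}" card] by blast
  then have "S = verts T" using grow[of S] by (meson not_less)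
  with S show ?thesis by (simp add: good_def)
qed

section \<open>The spectral radius\<close>

text \<open>
  The maximum \<open>M\<close> of the Rayleigh quotient is an eigenvalue, and it bounds every eigenvalue, as
  one sees by evaluating the form at an eigenvector.
\<close>

lemma nonneg_leading_eigenvector:
  assumes "graph G" "verts G \<noteq> {}"
  obtains x where "\<forall>v. 0 \<le> x v" "(\<Sum>v\<in>verts G. (x v)\<^sup>2) = 1" "graph_spectral_radius G \<ge> 0"
    "\<forall>u\<in>verts G. (\<Sum>v | v \<in> verts G \<and> (u, v) \<in> arcs_ends G. x v) = graph_spectral_radius G * x u"
proof -
  interpret graph G by fact
  let ?V = "verts G" and ?E = "arcs_ends G" and ?A = "adjacency_matrix G"
  have symE: "sym ?E" using sym_arcs by (simp add: symmetric_def)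
  obtain x M where x: "\<forall>v. 0 \<le> x v" and unit: "(\<Sum>v\<in>?V. (x v)\<^sup>2) = 1"
    and M: "adjacency_form ?E ?V x x = M"
    and max: "\<forall>z. adjacency_form ?E ?V z z \<le> M * (\<Sum>v\<in>?V. (z v)\<^sup>2)"
    by (rule nonneg_rayleigh_maximiser[OF finite_verts assms(2)])
  note max = max[rule_format]
  have restrict: "(\<Sum>v | v \<in> ?V \<and> (u, v) \<in> ?E. z v) = (\<Sum>v\<in>?V. of_bool ((u, v) \<in> ?E) * z v)"
    for u and z :: "'a \<Rightarrow> real"
    by (intro sum.mono_neutral_cong_left) auto
  have ev: "(\<Sum>v | v \<in> ?V \<and> (u, v) \<in> ?E. x v) = M * x u" if "u \<in> ?V" for u
    unfolding restrict using finite_verts symE unit M max that by (rule rayleigh_maximiser_eigenvector)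
  have "\<exists>v\<in>?V. x v \<noteq> 0"
  proof (rule ccontr)
    assume "\<not> ?thesis"
    then have "(\<Sum>v\<in>?V. (x v)\<^sup>2) = 0" by (intro sum.neutral) auto
    with unit show False by simp
  qed
  then have "eigenvalue ?A M"
    unfolding eigenvalue_adjacency_matrix_iff[OF finite_verts] using ev by blast
  then have "M \<in> spectrum ?A" by (simp add: spectrum_def)
  moreover have "k \<le> M" if "k \<in> spectrum ?A" for k
  proof -
    have "eigenvalue ?A k" using that by (simp add: spectrum_def)
    then obtain z w where z: "w \<in> ?V" "z w \<noteq> 0"
      "\<And>u. u \<in> ?V \<Longrightarrow> (\<Sum>v | v \<in> ?V \<and> (u, v) \<in> ?E. z v) = k * z u"
      unfolding eigenvalue_adjacency_matrix_iff[OF finite_verts] by blast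
    have "adjacency_form ?E ?V z z = (\<Sum>u\<in>?V. z u * (\<Sum>v\<in>?V. of_bool ((u, v) \<in> ?E) * z v))"
      unfolding adjacency_form_def sum_distrib_left by (intro sum.cong refl) simp
    also have "\<dots> = k * (\<Sum>v\<in>?V. (z v)\<^sup>2)"
    proof (subst sum_distrib_left, intro sum.cong refl)
      fix u assume "u \<in> ?V"
      then show "z u * (\<Sum>v\<in>?V. of_bool ((u, v) \<in> ?E) * z v) = k * (z u)\<^sup>2"
        unfolding restrict[symmetric] by (simp add: z(3) power2_eq_square)
    qed
    finally have "k * (\<Sum>v\<in>?V. (z v)\<^sup>2) \<le> M * (\<Sum>v\<in>?V. (z v)\<^sup>2)" using max[of z] by simp
    moreover have "(\<Sum>v\<in>?V. (z v)\<^sup>2) > 0"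
      using z by (intro sum_pos2[of _ w]) auto
    ultimately show ?thesis by simp
  qed
  moreover have "finite (spectrum ?A)"
    by (rule card_finite_spectrum(1)[of _ "length (vertex_list G)"]) (simp add: adjacency_matrix_def Let_def)
  ultimately have "Max (spectrum ?A) = M" by (intro Max_eqI)
  then have radius: "graph_spectral_radius G = M"
    using assms(2) by (simp add: graph_spectral_radius_def)
  have "M \<ge> 0"
    unfolding M[symmetric] adjacency_form_def using x by (intro sum_nonneg) simp
  then show ?thesis using x unit ev by (intro that[of x] ballI) (simp_all add: radius)
qed

lemma clique_free_card_le:
  assumes "graph G" "clique_free (r + 1) G" and C: "C \<subseteq> verts G"
    and clique: "\<forall>u\<in>C. \<forall>v\<in>C. u \<noteq> v \<longrightarrow> (u, v) \<in> arcs_ends G"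
  shows "card C \<le> r"
proof (rule ccontr)
  interpret graph G by fact
  assume "\<not> card C \<le> r"
  then obtain B where B: "B \<subseteq> C" "card B = r + 1" "finite B"
    by (metis Suc_eq_plus1 not_less_eq_eq obtain_subset_with_card_n)
  let ?H = "G \<restriction> B"
  have sub: "induced_subgraph ?H G" using B C by (intro induced_induce) auto
  then have "sym_digraph ?H" by (rule induced_graph_imp_graph)
  interpret H: wf_digraph ?H by (rule wellformed_induce_subgraph)
  have "graph ?H"
    using B no_loops no_multi_arcs \<open>sym_digraph ?H\<close>
    by (intro graph.intro digraph.intro pseudo_graph.intro fin_digraph.intro loopfree_digraph.intro
        nomulti_digraph.intro fin_digraph_axioms.intro loopfree_digraph_axioms.intro
        nomulti_digraph_axioms.intro H.wf_digraph) auto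
  moreover have "arcs_ends ?H = {(u, v). (u, v) \<in> B \<times> B \<and> u \<noteq> v}"
    using B clique no_loops by (fastforce simp: arcs_ends_conv)
  ultimately have "complete_digraph (r + 1) ?H" using B by (simp add: complete_digraph_def)
  with sub assms(2) show False by (auto simp: clique_free_def)
qed

lemma graph_homs_eq_homs_on:
  assumes "wf_digraph T"
  shows "graph_homs T G = homs_on (arcs_ends T) (verts T) (arcs_ends G) (verts G)"
proof -
  have "arcs_ends T \<subseteq> verts T \<times> verts T"
    by (auto dest: wf_digraph.adj_in_verts[OF assms])
  then show ?thesis unfolding graph_homs_def homs_on_def by blast
qed

theorem theorem1p3:
  fixes r l :: nat
    and T :: "('a, 'b) pre_digraph"
    and G :: "('c, 'd) pre_digraph"
  assumes "r \<ge> 2"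
    and "graph_tree T"
    and "card (verts T) = l"
    and "l \<ge> 1"
    and "graph G"
    and "clique_free (r + 1) G"
  shows "graph_spectral_radius G ^ l \<le> (1 - 1 / real r) * real (card (graph_homs T G))"
proof (cases "graph_spectral_radius G = 0")
  case True
  then show ?thesis using assms by (simp add: power_0_left)
next
  case False
  interpret G: graph G by fact
  interpret T: graph T using assms by (simp add: graph_tree_def)
  let ?k = "graph_spectral_radius G" and ?D = "arcs_ends G" and ?E = "arcs_ends T"
  have "verts G \<noteq> {}" using False by (auto simp: graph_spectral_radius_def)
  then obtain x where x: "\<forall>v. 0 \<le> x v" and unit: "(\<Sum>v\<in>verts G. (x v)\<^sup>2) = 1" and k: "?k \<ge> 0"
    and ev: "\<forall>u\<in>verts G. (\<Sum>v | v \<in> verts G \<and> (u, v) \<in> ?D. x v) = ?k * x u"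
    by (rule nonneg_leading_eigenvector[OF assms(5)])
  \<comment> \<open>The eigenvector may vanish on some components of \<open>G\<close>; the walk lives on its support.\<close>
  define W where "W = {v \<in> verts G. x v > 0}"
  have W: "W \<subseteq> verts G" "finite W" "\<And>v. v \<in> verts G - W \<Longrightarrow> x v = 0"
    using x by (auto simp: W_def intro: antisym simp flip: not_less)
  have symD: "sym ?D" and irrD: "irrefl ?D" and symE: "sym ?E" and irrE: "irrefl ?E"
    using G.sym_arcs T.sym_arcs G.adj_not_same T.adj_not_same
    by (auto simp: symmetric_def irrefl_def)
  have unit_W: "(\<Sum>v\<in>W. (x v)\<^sup>2) = 1"
    unfolding unit[symmetric] by (intro sum.mono_neutral_left) (simp_all add: W(1,3))
  interpret positive_eigenvector ?D W x ?k
  proof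
    fix a assume "a \<in> W"
    then have "(\<Sum>v | v \<in> verts G \<and> (a, v) \<in> ?D. x v) = ?k * x a" using ev W(1) by blast
    moreover have "(\<Sum>v | v \<in> W \<and> (a, v) \<in> ?D. x v) = (\<Sum>v | v \<in> verts G \<and> (a, v) \<in> ?D. x v)"
      using W(1) by (intro sum.mono_neutral_left) (auto intro: W(3))
    ultimately show "(\<Sum>v | v \<in> W \<and> (a, v) \<in> ?D. x v) = ?k * x a" by simp
    show "0 < x a" using \<open>a \<in> W\<close> by (simp add: W_def)
  next
    show "0 < ?k" using k False by simp
  qed (rule W(2) symD unit_W)+
  let ?h = "card (homs_on ?E (verts T) ?D W)" and ?q = "adjacency_form ?D W (\<lambda>a. (x a)\<^sup>2) (\<lambda>a. (x a)\<^sup>2)"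
  have built: "built_by_leaves ?E (verts T)" using assms(2) by (rule graph_tree_built_by_leaves)
  have finh: "finite (homs_on ?E (verts T) ?D (verts G))"
    by (simp add: finite_homs_on)
  have sub: "homs_on ?E (verts T) ?D W \<subseteq> homs_on ?E (verts T) ?D (verts G)"
    using W(1) by (auto simp: homs_on_def PiE_iff)
  have h: "?h > 0" "vertex_entropy + (real l - 1) * ln ?k \<le> ln ?h"
    using entropy_le_ln_card_homs[OF built symE irrE] assms(3) finite_subset[OF sub finh]
    by (simp_all add: card_gt_0_iff)
  have q: "?q \<le> 1 - 1 / real r"
  proof (rule motzkin_straus)
    fix C assume "C \<subseteq> W" "\<forall>u\<in>C. \<forall>v\<in>C. u \<noteq> v \<longrightarrow> (u, v) \<in> ?D"
    with W(1) show "card C \<le> r"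
      by (intro clique_free_card_le[OF assms(5,6)]) blast+
  qed (simp_all add: W(2) unit_W symD irrD)
  have "?q > 0" by (rule stationary_form_pos)
  have "real l * ln ?k \<le> ln ?q + ln ?h"
    using h(2) ln_eigenvalue_le by (simp add: algebra_simps)
  then have "ln (?k ^ l) \<le> ln (?q * ?h)"
    using k_pos h(1) \<open>?q > 0\<close> by (simp add: ln_realpow ln_mult)
  then have "?k ^ l \<le> ?q * ?h"
    using k_pos h(1) \<open>?q > 0\<close> by simp
  also have "\<dots> \<le> (1 - 1 / real r) * card (homs_on ?E (verts T) ?D (verts G))"
    using q \<open>?q > 0\<close> card_mono[OF finh sub] by (intro mult_mono) auto
  finally show ?thesis by (simp add: graph_homs_eq_homs_on[OF T.wf_digraph])
qed

end
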